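(* Let $r\ge1$ and $k=m_0>m_1>\dots>m_r>0$ be integers. Then $$\bigl(1-xR_{m_0-m_1-1}(x)-xR_{m_r}(x)\bigr)F_{[m_0,\dots,m_r]}(x)=1-xR_{m_0-m_1-1}(x)F_{[m_1,\dots,m_r]}(x)+x\sum_{j=2}^rF_{[m_0-m_j,\dots,m_{j-1}-m_j]}(x)\bigl(F_{[m_{j-1},\dots,m_r]}(x)-F_{[m_j,\dots,m_r]}(x)\bigr).$$
   Context: A permutation $\alpha\in S_n$ contains a pattern $\tau\in S_k$ if there are indices $1\le i_1<\dots<i_k\le n$ with $(\alpha_{i_1},\dots,\alpha_{i_k})$ order-isomorphic to $\tau$; otherwise it avoids $\tau$. For a pattern $\tau$, $f_\tau(n)$ is the number of permutations in $S_n$ avoiding both $132$ and $\tau$ ($S_0$ consists of the empty permutation), and $F_\tau(x)=\sum_{n\ge0}f_\tau(n)x^n$. Layered patterns: for integers $m_0>m_1>\dots>m_r>m_{r+1}=0$, $[m_0,\dots,m_r]$ denotes the permutation of $\{1,\dots,m_0\}$ given by $(m_1+1,m_1+2,\dots,m_0,\ m_2+1,\dots,m_1,\ \dots,\ 1,2,\dots,m_r)$, i.e. the concatenation of the increasing blocks $(m_{i+1}+1,\dots,m_i)$, $i=0,\dots,r$; in particular $[k]=(1,2,\dots,k)$. $U_p$ is the Chebyshev polynomial of the second kind, $U_p(\cos\theta)=\sin((p+1)\theta)/\sin\theta$, with $U_{-1}=0$. For $p\ge0$, $R_p(x)=\dfrac{U_{p-1}\left(\frac1{2\sqrt x}\right)}{\sqrt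 x\,U_p\left(\frac1{2\sqrt x}\right)}$ (a rational function of $x$; $R_0=0$). *)

theory Defs
  imports
    Complex_Main
    "HOL-Computational_Algebra.Computational_Algebra"
    "HOL-Combinatorics.Multiset_Permutations"
begin

section \<open>Pattern avoidance\<close>

text \<open>
  Permutations are lists in one-line notation, so that
  \<^term>\<open>permutations_of_set {1..n::nat}\<close> plays the role of the symmetric group of degree n;
  list positions are counted from 0.
\<close>

definition contains_pattern :: "nat list \<Rightarrow> nat list \<Rightarrow> bool" where
  "contains_pattern \<alpha> \<tau> \<longleftrightarrow>
     (\<exists>i::nat \<Rightarrow> nat. strict_mono_on {..<length \<tau>} i \<and> i ` {..<length \<tau>} \<subseteq> {..<length \<alpha>} \<and>
        (\<forall>a<length \<tau>. \<forall>b<length \<tau>. \<alpha> ! i a < \<alpha> ! i b \<longleftrightarrow> \<tau> ! a < \<tau> ! b))"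

definition count_avoiding :: "nat list \<Rightarrow> nat \<Rightarrow> nat" where
  "count_avoiding \<tau> n =
     card {\<alpha> \<in> permutations_of_set {1..n}.
             \<not> contains_pattern \<alpha> [1, 3, 2] \<and> \<not> contains_pattern \<alpha> \<tau>}"

definition avoiding_gf :: "nat list \<Rightarrow> real fps" where
  "avoiding_gf \<tau> = Abs_fps (\<lambda>n. of_nat (count_avoiding \<tau> n))"

text \<open>The argument is the list of block endpoints, to which the final endpoint 0 is appended.\<close>

definition layered :: "nat list \<Rightarrow> nat list" where
  "layered ms =
     concat (map (\<lambda>i. [Suc ((ms @ [0]) ! Suc i) ..< Suc ((ms @ [0]) ! i)]) [0..<length ms])"

abbreviation layered_gf :: "nat list \<Rightarrow> real fps" where
  "layered_gf ms \<equiv> avoiding_gf (layered ms)"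


section \<open>Chebyshev polynomials of the second kind\<close>

text \<open>
  The index is an integer so as to include -1, for which the defining formula gives the
  zero polynomial; the definition is only meaningful for indices at least -1.
\<close>

definition chebyshev_U :: "int \<Rightarrow> real poly" where
  "chebyshev_U p =
     (THE u. \<forall>\<theta>. sin \<theta> \<noteq> 0 \<longrightarrow> poly u (cos \<theta>) = sin ((of_int p + 1) * \<theta>) / sin \<theta>)"

lemma chebyshev_U_unique:
  fixes u v :: "real poly"
  assumes "\<And>\<theta>. sin \<theta> \<noteq> 0 \<Longrightarrow> poly u (cos \<theta>) = poly v (cos \<theta>)"
  shows "u = v"
proof (rule ccontr)
  assume "u \<noteq> v"
  then have "finite {t. poly (u - v) t = 0}"
    by (intro poly_roots_finite) auto
  moreover have "{-1<..<1} \<subseteq> {t. poly (u - v) t = 0}"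
  proof
    fix t :: real assume t: "t \<in> {-1<..<1}"
    then have "sin (arccos t) \<noteq> 0" by (intro sin_arccos_nonzero) auto
    with assms[of "arccos t"] t show "t \<in> {t. poly (u - v) t = 0}" by simp
  qed
  ultimately have "finite {-1<..<1::real}" by (rule finite_subset[rotated])
  then show False by (simp add: infinite_Ioo)
qed

lemma chebyshev_U_eqI:
  assumes "\<And>\<theta>. sin \<theta> \<noteq> 0 \<Longrightarrow> poly u (cos \<theta>) = sin ((of_int p + 1) * \<theta>) / sin \<theta>"
  shows "chebyshev_U p = u"
  unfolding chebyshev_U_def
proof (rule the_equality)
  fix v :: "real poly"
  assume "\<forall>\<theta>. sin \<theta> \<noteq> 0 \<longrightarrow> poly v (cos \<theta>) = sin ((of_int p + 1) * \<theta>) / sin \<theta>"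
  with assms show "v = u" by (intro chebyshev_U_unique) simp
qed (use assms in blast)

lemma chebyshev_U_minus_1 [simp]: "chebyshev_U (-1) = 0"
  by (rule chebyshev_U_eqI) simp

lemma chebyshev_U_0 [simp]: "chebyshev_U 0 = 1"
  by (rule chebyshev_U_eqI) simp

lemma chebyshev_U_aux:
  "(\<forall>\<theta>. sin \<theta> \<noteq> 0 \<longrightarrow>
      poly (chebyshev_U (int n - 1)) (cos \<theta>) = sin (real n * \<theta>) / sin \<theta>) \<and>
   (\<forall>\<theta>. sin \<theta> \<noteq> 0 \<longrightarrow>
      poly (chebyshev_U (int n)) (cos \<theta>) = sin ((real n + 1) * \<theta>) / sin \<theta>) \<and>
   chebyshev_U (int n + 1) = [:0, 2:] * chebyshev_U (int n) - chebyshev_U (int n - 1)"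
proof (induction n)
  case 0
  have "chebyshev_U 1 = [:0, 2:]"
    by (rule chebyshev_U_eqI) (simp add: sin_double mult.commute[of _ 2])
  then show ?case by simp
next
  case (Suc n)
  let ?w = "\<lambda>n. [:0, 2:] * chebyshev_U (int n) - chebyshev_U (int n - 1)"
  have trig: "2 * cos \<theta> * sin ((x + 1) * \<theta>) - sin (x * \<theta>) = sin ((x + 2) * \<theta>)" for x \<theta> :: real
  proof -
    have "sin ((x + 2) * \<theta>) = sin ((x + 1) * \<theta> + \<theta>)" "sin (x * \<theta>) = sin ((x + 1) * \<theta> - \<theta>)"
      by (simp_all add: algebra_simps)
    then show ?thesis by (simp add: sin_add sin_diff)
  qed
  have step: "poly (?w k) (cos \<theta>) = sin ((real k + 2) * \<theta>) / sin \<theta>"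
    if "sin \<theta> \<noteq> 0"
      "poly (chebyshev_U (int k)) (cos \<theta>) = sin ((real k + 1) * \<theta>) / sin \<theta>"
      "poly (chebyshev_U (int k - 1)) (cos \<theta>) = sin (real k * \<theta>) / sin \<theta>" for k \<theta>
  proof -
    have "poly (?w k) (cos \<theta>) =
        (2 * cos \<theta> * sin ((real k + 1) * \<theta>) - sin (real k * \<theta>)) / sin \<theta>"
      by (simp add: that(2,3) diff_divide_distrib)
    then show ?thesis by (simp only: trig)
  qed
  have 1: "poly (chebyshev_U (int n + 1)) (cos \<theta>) = sin ((real n + 2) * \<theta>) / sin \<theta>"
    if "sin \<theta> \<noteq> 0" for \<theta>
    using Suc step that by metis
  have "chebyshev_U (int (Suc n) + 1) = ?w (Suc n)"
  proof (rule chebyshev_U_eqI)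
    fix \<theta> :: real assume *: "sin \<theta> \<noteq> 0"
    have "poly (?w (Suc n)) (cos \<theta>) = sin ((real (Suc n) + 2) * \<theta>) / sin \<theta>"
      by (rule step) (use * 1[OF *] Suc in \<open>simp_all add: add_ac\<close>)
    then show "poly (?w (Suc n)) (cos \<theta>) =
        sin ((real_of_int (int (Suc n) + 1) + 1) * \<theta>) / sin \<theta>"
      by (simp add: add_ac)
  qed
  with 1 Suc show ?case by (simp add: add_ac)
qed

lemma poly_chebyshev_U_cos:
  assumes "p \<ge> -1" "sin \<theta> \<noteq> 0"
  shows "poly (chebyshev_U p) (cos \<theta>) = sin ((of_int p + 1) * \<theta>) / sin \<theta>"
proof (cases "p = -1")
  case False
  with assms have "p = int (nat p)" by simp
  then show ?thesis using chebyshev_U_aux[of "nat p"] assms(2) by (metis of_int_of_nat_eq)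
qed simp

lemma chebyshev_U_rec:
  "chebyshev_U (int n + 1) = [:0, 2:] * chebyshev_U (int n) - chebyshev_U (int n - 1)"
  using chebyshev_U_aux by blast


section \<open>The rational functions R\<close>

definition poly_fls :: "real poly \<Rightarrow> real fls \<Rightarrow> real fls" where
  "poly_fls u t = poly (map_poly fls_const u) t"

text \<open>
  The rational function R of x is identified with its power series expansion at 0. The square
  root of x is made formal: \<^term>\<open>fls_X\<close> below is the square root of x, all computations take place in
  the field of Laurent series in it, and the substitution of \<^term>\<open>fps_X ^ 2\<close> embeds the series in x.
  Existence and uniqueness are lemma \<open>cheb_R_ex1\<close>.
\<close>

definition cheb_R_quot :: "nat \<Rightarrow> real fls" where
  "cheb_R_quot p = poly_fls (chebyshev_U (int p - 1)) (1 / (2 * fls_X)) /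
                   (fls_X * poly_fls (chebyshev_U (int p)) (1 / (2 * fls_X)))"

definition cheb_R :: "nat \<Rightarrow> real fps" where
  "cheb_R p = (THE R. fps_to_fls (R oo fps_X ^ 2) = cheb_R_quot p)"

lemma poly_fls_0 [simp]: "poly_fls 0 t = 0"
  and poly_fls_1 [simp]: "poly_fls 1 t = 1"
  by (simp_all add: poly_fls_def)

lemma map_poly_fls_const_diff:
  "map_poly fls_const (u - v) = map_poly fls_const u - map_poly fls_const (v :: real poly)"
  by (rule poly_eqI) (simp add: coeff_map_poly fls_minus_const)

lemma poly_fls_rec:
  "poly_fls ([:0, 2:] * u - v) t = 2 * t * poly_fls u t - poly_fls v t"
proof -
  have "[:0, 2:] * u = pCons 0 (smult 2 u)" by simp
  moreover have "map_poly fls_const (smult 2 u) = smult (fls_const 2) (map_poly fls_const u)"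
    by (rule map_poly_smult) simp_all
  ultimately show ?thesis
    by (simp add: poly_fls_def map_poly_fls_const_diff map_poly_pCons algebra_simps)
qed

lemma cheb_R_quot_0: "cheb_R_quot 0 = 0"
  by (simp add: cheb_R_quot_def)

lemma cheb_R_quot_Suc_aux:
  "poly_fls (chebyshev_U (int p)) (1 / (2 * fls_X)) \<noteq> 0 \<and>
   (\<exists>R. fps_to_fls (R oo fps_X ^ 2) = cheb_R_quot p \<and>
        fps_to_fls (inverse (1 - fps_X * R) oo fps_X ^ 2) = cheb_R_quot (Suc p))"
proof (induction p)
  have step: "poly_fls (chebyshev_U (int p + 1)) (1 / (2 * fls_X)) \<noteq> 0 \<and>
     fps_to_fls (inverse (1 - fps_X * R) oo fps_X ^ 2) = cheb_R_quot (Suc p)"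
    if nz: "poly_fls (chebyshev_U (int p)) (1 / (2 * fls_X)) \<noteq> 0"
      and R: "fps_to_fls (R oo fps_X ^ 2) = cheb_R_quot p" for p R
  proof -
    define a where "a = poly_fls (chebyshev_U (int p - 1)) (1 / (2 * fls_X))"
    define b where "b = poly_fls (chebyshev_U (int p)) (1 / (2 * fls_X))"
    define c where "c = poly_fls (chebyshev_U (int p + 1)) (1 / (2 * fls_X))"
    have b: "b \<noteq> 0" using nz by (simp add: b_def)
    have "c = 2 * (1 / (2 * fls_X)) * b - a"
      unfolding a_def b_def c_def chebyshev_U_rec poly_fls_rec ..
    also have "2 * (1 / (2 * fls_X)) = (1 / fls_X :: real fls)"
      by (simp add: divide_simps)
    finally have c: "c = b / fls_X - a"
      by (metis mult.commute times_divide_eq_right mult.right_neutral)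
    let ?D = "1 - fps_X * R :: real fps"
    have D: "?D oo fps_X ^ 2 = 1 - fps_X ^ 2 * (R oo fps_X ^ 2)"
      by (simp add: fps_compose_sub_distrib fps_compose_mult_distrib)
    have D': "fps_to_fls (?D oo fps_X ^ 2) = 1 - fls_X ^ 2 * cheb_R_quot p"
      by (simp add: D fps_to_fls_minus fls_times_fps_to_fls fps_to_fls_power R)
    have q: "cheb_R_quot p = a / (fls_X * b)"
      by (simp add: cheb_R_quot_def a_def b_def)
    have D'': "fps_to_fls (?D oo fps_X ^ 2) = fls_X * c / b"
    proof -
      have "1 - X ^ 2 * (a / (X * b)) = X * (b / X - a) / b" if "X \<noteq> 0" for X :: "real fls"
        using that b by (simp add: field_simps power2_eq_square)
      from this[OF fls_X_nonzero] show ?thesis unfolding D' q c .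
    qed
    have "(?D oo fps_X ^ 2) $ 0 = 1" by simp
    then have "?D oo fps_X ^ 2 \<noteq> 0" by (metis fps_zero_nth zero_neq_one)
    with D'' have cnz: "c \<noteq> 0" by auto
    have "inverse ?D * ?D = 1" by (rule inverse_mult_eq_1) simp
    then have "(inverse ?D oo fps_X ^ 2) * (?D oo fps_X ^ 2) = 1"
      by (metis fps_compose_1 fps_compose_mult_distrib fps_X_power_nth zero_neq_numeral)
    then have "fps_to_fls (inverse ?D oo fps_X ^ 2) * (fls_X * c / b) = 1"
      by (metis D'' fls_times_fps_to_fls fps_one_to_fls)
    then have "fps_to_fls (inverse ?D oo fps_X ^ 2) = b / (fls_X * c)"
      using b cnz by (simp add: field_simps)
    also have "\<dots> = cheb_R_quot (Suc p)"
      by (simp add: cheb_R_quot_def b_def c_def add_ac)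
    finally show ?thesis using cnz by (simp add: c_def)
  qed
  {
    case 0
    have "poly_fls (chebyshev_U (int 0)) (1 / (2 * fls_X)) \<noteq> 0" by simp
    moreover have "fps_to_fls (0 oo fps_X ^ 2) = cheb_R_quot 0" by (simp add: cheb_R_quot_0)
    ultimately show ?case using step[of 0 0] by blast
  next
    case (Suc p)
    then obtain R where
      nz: "poly_fls (chebyshev_U (int p)) (1 / (2 * fls_X)) \<noteq> 0" and
      R: "fps_to_fls (R oo fps_X ^ 2) = cheb_R_quot p" by blast
    from step[OF nz R] have
      nz': "poly_fls (chebyshev_U (int (Suc p))) (1 / (2 * fls_X)) \<noteq> 0" and
      R': "fps_to_fls (inverse (1 - fps_X * R) oo fps_X ^ 2) = cheb_R_quot (Suc p)"
      by (simp_all add: add_ac)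
    from step[OF nz' R'] nz' R' show ?case by blast
  }
qed

lemma cheb_R_ex1: "\<exists>!R. fps_to_fls (R oo fps_X ^ 2) = cheb_R_quot p"
proof -
  have "R = S" if "R oo fps_X ^ 2 = S oo fps_X ^ 2" for R S :: "real fps"
  proof -
    have "(R - S) oo fps_X ^ 2 = 0" using that by (simp add: fps_compose_sub_distrib)
    then show ?thesis by (subst (asm) fps_compose_eq_0_iff) auto
  qed
  then show ?thesis using cheb_R_quot_Suc_aux[of p] by (metis fps_to_fls_eq_iff)
qed

lemma fps_to_fls_cheb_R: "fps_to_fls (cheb_R p oo fps_X ^ 2) = cheb_R_quot p"
  unfolding cheb_R_def by (rule theI'[OF cheb_R_ex1])

lemma cheb_R_0: "cheb_R 0 = 0"
  using cheb_R_ex1[of 0] fps_to_fls_cheb_R[of 0] by (metis cheb_R_quot_0 fps_compose_0 fps_zero_to_fls)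

lemma cheb_R_Suc: "cheb_R (Suc p) = inverse (1 - fps_X * cheb_R p)"
  using cheb_R_ex1[of p] cheb_R_ex1[of "Suc p"] fps_to_fls_cheb_R[of p] fps_to_fls_cheb_R[of "Suc p"]
    cheb_R_quot_Suc_aux[of p] by metis

end

theory Submission
  imports Defs "HOL-Library.Sublist"
begin

text \<open>
  A 132-avoiding permutation with maximum \<open>n\<close> is \<open>a @ [n] @ b\<close> with \<open>a\<close>, \<open>b\<close> avoiding 132 and \<open>a\<close>
  lying above \<open>b\<close>. An occurrence of a layered pattern is cut by this decomposition at a block
  boundary: the first \<open>j\<close> blocks occur in \<open>a @ [n]\<close> and the others in \<open>b\<close>. The first \<open>j\<close> blocks
  (\<open>head_pattern\<close>) are increasingly harder to contain and the remaining ones increasingly easier, so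
  classifying the permutations by the least \<open>j\<close> such that \<open>a\<close> avoids the first \<open>j\<close> blocks
  expresses the generating function as a sum of products. Summation by parts gives the claimed form.
  For \<open>[p]\<close> the same decomposition is the recurrence of the functions R.
\<close>

section \<open>Containment of patterns\<close>

text \<open>Quantifying over the pairs of a zip, not over positions, turns concatenation of lists
  into union of sets of pairs; \<open>order_iso_nth\<close> gives the positional form that
  \<open>contains_pattern\<close> uses.\<close>

definition order_iso :: "nat list \<Rightarrow> nat list \<Rightarrow> bool" where
  "order_iso xs ys \<longleftrightarrow> length xs = length ys \<and>
     (\<forall>p \<in> set (zip xs ys). \<forall>q \<in> set (zip xs ys). fst p < fst q \<longleftrightarrow> snd p < snd q)"

definition lies_above :: "nat list \<Rightarrow> nat list \<Rightarrow> bool" where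
  "lies_above xs ys \<longleftrightarrow> (\<forall>x \<in> set xs. \<forall>y \<in> set ys. y < x)"

lemma subseq_imp_subset: "subseq xs ys \<Longrightarrow> set xs \<subseteq> set ys"
  by (induction rule: list_emb.induct) auto

lemma order_iso_nth:
  "order_iso xs ys \<longleftrightarrow> length xs = length ys \<and>
     (\<forall>a<length ys. \<forall>b<length ys. xs ! a < xs ! b \<longleftrightarrow> ys ! a < ys ! b)"
  unfolding order_iso_def by (auto simp: set_zip) (metis fst_conv snd_conv)+

text \<open>The last index \<open>i l\<close> cuts \<open>xs\<close> in two: all earlier indices are
  smaller, so the induction hypothesis applies to the prefix of length \<open>i l\<close>.\<close>

lemma subseq_nth_strict_mono:
  assumes "strict_mono_on {..<l} i" "i ` {..<l} \<subseteq> {..<length xs}"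
  shows "subseq (map (\<lambda>a. xs ! i a) [0..<l]) xs"
  using assms
proof (induction l arbitrary: xs)
  case (Suc l)
  have less: "i a < i l" if "a < l" for a
    using Suc.prems(1) that by (auto simp: strict_mono_on_def)
  have il: "i l < length xs" using Suc.prems(2) by auto
  have "subseq (map (\<lambda>a. take (i l) xs ! i a) [0..<l]) (take (i l) xs)"
    by (rule Suc.IH) (use Suc.prems less il in \<open>auto simp: strict_mono_on_def\<close>)
  moreover have "map (\<lambda>a. take (i l) xs ! i a) [0..<l] = map (\<lambda>a. xs ! i a) [0..<l]"
    using less by simp
  ultimately have "subseq (map (\<lambda>a. xs ! i a) [0..<l] @ [xs ! i l])
      (take (i l) xs @ (xs ! i l # drop (Suc (i l)) xs))"
    by (intro list_emb_append_mono) auto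
  then show ?case using il by (simp add: id_take_nth_drop[symmetric])
qed simp

lemma subseq_imp_index_map:
  "subseq ys xs \<Longrightarrow> \<exists>i. strict_mono_on {..<length ys} i \<and> i ` {..<length ys} \<subseteq> {..<length xs} \<and>
     (\<forall>a<length ys. xs ! i a = ys ! a)"
proof (induction rule: list_emb.induct)
  case (list_emb_Nil ys)
  show ?case by (auto simp: strict_mono_on_def)
next
  case (list_emb_Cons ys xs x)
  then obtain i where "strict_mono_on {..<length ys} i" "i ` {..<length ys} \<subseteq> {..<length xs}"
     "\<forall>a<length ys. xs ! i a = ys ! a" by auto
  then show ?case by (intro exI[of _ "\<lambda>a. Suc (i a)"]) (auto simp: strict_mono_on_def)
next
  case (list_emb_Cons2 x y ys xs)
  then obtain i where i: "strict_mono_on {..<length ys} i" "i ` {..<length ys} \<subseteq> {..<length xs}"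
     "\<forall>a<length ys. xs ! i a = ys ! a" by auto
  \<comment> \<open>The new head goes to position 0, and every earlier choice moves one place to the
    right on both sides.\<close>
  let ?j = "\<lambda>a. case a of 0 \<Rightarrow> 0 | Suc b \<Rightarrow> Suc (i b)"
  have "strict_mono_on {..<length (x # ys)} ?j"
    using i(1) by (auto simp: strict_mono_on_def split: nat.splits)
  moreover have "?j ` {..<length (x # ys)} \<subseteq> {..<length (y # xs)}"
    using i(2) by (force split: nat.splits)
  moreover have "\<forall>a<length (x # ys). (y # xs) ! ?j a = (x # ys) ! a"
    using i(3) list_emb_Cons2 by (auto split: nat.splits)
  ultimately show ?case by blast
qed

text \<open>Trades index functions for sublists, so that occurrences can be split along an
  append.\<close>

lemma contains_pattern_subseq:
  "contains_pattern \<alpha> \<tau> \<longleftrightarrow> (\<exists>ys. subseq ys \<alpha> \<and> order_iso ys \<tau>)"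
proof
  assume "contains_pattern \<alpha> \<tau>"
  then obtain i where i: "strict_mono_on {..<length \<tau>} i" "i ` {..<length \<tau>} \<subseteq> {..<length \<alpha>}"
    "\<forall>a<length \<tau>. \<forall>b<length \<tau>. \<alpha> ! i a < \<alpha> ! i b \<longleftrightarrow> \<tau> ! a < \<tau> ! b"
    unfolding contains_pattern_def by blast
  have "order_iso (map (\<lambda>a. \<alpha> ! i a) [0..<length \<tau>]) \<tau>"
    unfolding order_iso_nth using i(3) by simp
  with subseq_nth_strict_mono[OF i(1,2)] show "\<exists>ys. subseq ys \<alpha> \<and> order_iso ys \<tau>" by blast
next
  assume "\<exists>ys. subseq ys \<alpha> \<and> order_iso ys \<tau>"
  then obtain ys where ys: "subseq ys \<alpha>" "order_iso ys \<tau>" by blast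
  from subseq_imp_index_map[OF ys(1)] ys(2) show "contains_pattern \<alpha> \<tau>"
    unfolding contains_pattern_def order_iso_nth by metis
qed

lemma contains_pattern_trans:
  assumes "contains_pattern \<alpha> \<beta>" "contains_pattern \<beta> \<tau>"
  shows "contains_pattern \<alpha> \<tau>"
proof -
  from assms obtain i j where
    i: "strict_mono_on {..<length \<beta>} i" "i ` {..<length \<beta>} \<subseteq> {..<length \<alpha>}"
      "\<forall>a<length \<beta>. \<forall>b<length \<beta>. \<alpha> ! i a < \<alpha> ! i b \<longleftrightarrow> \<beta> ! a < \<beta> ! b" and
    j: "strict_mono_on {..<length \<tau>} j" "j ` {..<length \<tau>} \<subseteq> {..<length \<beta>}"
      "\<forall>a<length \<tau>. \<forall>b<length \<tau>. \<beta> ! j a < \<beta> ! j b \<longleftrightarrow> \<tau> ! a < \<tau> ! b"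
    unfolding contains_pattern_def by blast
  have jl: "j a < length \<beta>" if "a < length \<tau>" for a using j(2) that by auto
  show ?thesis unfolding contains_pattern_def
  proof (intro exI[of _ "\<lambda>a. i (j a)"] conjI)
    show "strict_mono_on {..<length \<tau>} (\<lambda>a. i (j a))"
      using i(1) j(1) jl by (auto simp: strict_mono_on_def)
    show "(\<lambda>a. i (j a)) ` {..<length \<tau>} \<subseteq> {..<length \<alpha>}" using i(2) jl by auto
    show "\<forall>a<length \<tau>. \<forall>b<length \<tau>. \<alpha> ! i (j a) < \<alpha> ! i (j b) \<longleftrightarrow> \<tau> ! a < \<tau> ! b"
      using i(3) j(3) jl by simp
  qed
qed

lemma contains_pattern_Nil [simp]: "contains_pattern \<alpha> []"
  unfolding contains_pattern_def by (auto simp: strict_mono_on_def)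

lemma Nil_contains_pattern [simp]: "contains_pattern [] \<tau> \<longleftrightarrow> \<tau> = []"
  unfolding contains_pattern_def by auto

lemma order_iso_refl: "order_iso xs xs"
  unfolding order_iso_nth by simp

lemma subseq_imp_contains_pattern: "subseq ys xs \<Longrightarrow> contains_pattern xs ys"
  using contains_pattern_subseq order_iso_refl by blast

lemma order_iso_map:
  assumes "\<And>x y. x \<in> set xs \<Longrightarrow> y \<in> set xs \<Longrightarrow> f x < f y \<longleftrightarrow> x < y"
  shows "order_iso (map f xs) xs" "order_iso xs (map f xs)"
  using assms unfolding order_iso_nth by auto

text \<open>A list and its image under a map increasing on its entries contain each other, so
  transitivity settles both sides at once.\<close>

lemma contains_pattern_map:
  assumes "\<And>x y. x \<in> set xs \<Longrightarrow> y \<in> set xs \<Longrightarrow> f x < f y \<longleftrightarrow> x < y"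
  shows "contains_pattern (map f xs) \<tau> \<longleftrightarrow> contains_pattern xs \<tau>"
    and "contains_pattern \<alpha> (map f xs) \<longleftrightarrow> contains_pattern \<alpha> xs"
proof -
  have "contains_pattern (map f xs) xs" "contains_pattern xs (map f xs)"
    using order_iso_map[of xs f, OF assms] unfolding contains_pattern_subseq by blast+
  then show "contains_pattern (map f xs) \<tau> \<longleftrightarrow> contains_pattern xs \<tau>"
    and "contains_pattern \<alpha> (map f xs) \<longleftrightarrow> contains_pattern \<alpha> xs"
    using contains_pattern_trans by blast+
qed

text \<open>Every comparison between the two parts of the left list has a known outcome, so only
  comparisons inside a part remain, together with the demand that the pattern is stacked in the same
  way.\<close>

lemma order_iso_append:
  assumes "lies_above xs xs'" "length xs = length ys"
  shows "order_iso (xs @ xs') (ys @ ys') \<longleftrightarrow>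
    order_iso xs ys \<and> order_iso xs' ys' \<and> lies_above ys ys'"
proof
  assume *: "order_iso (xs @ xs') (ys @ ys')"
  then have len: "length xs' = length ys'" using assms by (simp add: order_iso_def)
  have zip: "zip (xs @ xs') (ys @ ys') = zip xs ys @ zip xs' ys'" using assms by simp
  have "lies_above ys ys'" unfolding lies_above_def
  proof (intro ballI)
    fix y y' assume "y \<in> set ys" "y' \<in> set ys'"
    then obtain x x' where x: "(x, y) \<in> set (zip xs ys)" "(x', y') \<in> set (zip xs' ys')"
      using assms len by (metis in_set_impl_in_set_zip2)
    then have "x' < x" using assms(1) by (meson lies_above_def set_zip_leftD)
    moreover have "fst (x', y') < fst (x, y) \<longleftrightarrow> snd (x', y') < snd (x, y)"
      using * x unfolding order_iso_def zip set_append by blast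
    ultimately show "y' < y" by simp
  qed
  with * len assms show "order_iso xs ys \<and> order_iso xs' ys' \<and> lies_above ys ys'"
    unfolding order_iso_def zip by simp
next
  assume *: "order_iso xs ys \<and> order_iso xs' ys' \<and> lies_above ys ys'"
  then have zip: "zip (xs @ xs') (ys @ ys') = zip xs ys @ zip xs' ys'" by (simp add: order_iso_def)
  have "fst q < fst p \<and> snd q < snd p" if "p \<in> set (zip xs ys)" "q \<in> set (zip xs' ys')" for p q
    using that assms * unfolding lies_above_def
    by (metis prod.collapse set_zip_leftD set_zip_rightD)
  then have cross: "(fst p < fst q \<longleftrightarrow> snd p < snd q) \<and> (fst q < fst p \<longleftrightarrow> snd q < snd p)"
    if "p \<in> set (zip xs ys)" "q \<in> set (zip xs' ys')" for p q
    using that less_asym by blast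
  show "order_iso (xs @ xs') (ys @ ys')"
    unfolding order_iso_def zip set_append
  proof (intro conjI ballI)
    fix p q
    assume "p \<in> set (zip xs ys) \<union> set (zip xs' ys')" "q \<in> set (zip xs ys) \<union> set (zip xs' ys')"
    then show "fst p < fst q \<longleftrightarrow> snd p < snd q"
      using cross[of p q] cross[of q p] * unfolding order_iso_def by blast
  qed (use * in \<open>simp add: order_iso_def\<close>)
qed

text \<open>An occurrence consists of a portion in \<open>\<alpha>\<close> followed by one in
  \<open>\<beta>\<close>; the length of the first portion tells where the pattern is cut.\<close>

lemma contains_pattern_append:
  assumes "lies_above \<alpha> \<beta>"
  shows "contains_pattern (\<alpha> @ \<beta>) \<tau> \<longleftrightarrow> (\<exists>\<sigma> \<rho>. \<tau> = \<sigma> @ \<rho> \<and> lies_above \<sigma> \<rho> \<and>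
    contains_pattern \<alpha> \<sigma> \<and> contains_pattern \<beta> \<rho>)"
proof
  assume "contains_pattern (\<alpha> @ \<beta>) \<tau>"
  then obtain xs ys where xy: "subseq xs \<alpha>" "subseq ys \<beta>" "order_iso (xs @ ys) \<tau>"
    unfolding contains_pattern_subseq by (metis subseq_appendE)
  have above: "lies_above xs ys"
    using assms subseq_imp_subset[OF xy(1)] subseq_imp_subset[OF xy(2)]
    unfolding lies_above_def by blast
  define \<sigma> \<rho> where "\<sigma> = take (length xs) \<tau>" and "\<rho> = drop (length xs) \<tau>"
  have "\<tau> = \<sigma> @ \<rho>" "length xs = length \<sigma>"
    using xy(3) by (auto simp: \<sigma>_def \<rho>_def order_iso_def)
  with order_iso_append[OF above, of \<sigma> \<rho>] xy
  show "\<exists>\<sigma> \<rho>. \<tau> = \<sigma> @ \<rho> \<and> lies_above \<sigma> \<rho> \<and> contains_pattern \<alpha> \<sigma> \<and> contains_pattern \<beta> \<rho>"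
    unfolding contains_pattern_subseq by blast
next
  assume "\<exists>\<sigma> \<rho>. \<tau> = \<sigma> @ \<rho> \<and> lies_above \<sigma> \<rho> \<and> contains_pattern \<alpha> \<sigma> \<and> contains_pattern \<beta> \<rho>"
  then obtain \<sigma> \<rho> xs ys where *: "\<tau> = \<sigma> @ \<rho>" "lies_above \<sigma> \<rho>" "subseq xs \<alpha>" "order_iso xs \<sigma>"
    "subseq ys \<beta>" "order_iso ys \<rho>"
    unfolding contains_pattern_subseq by blast
  have above: "lies_above xs ys"
    using assms subseq_imp_subset[OF *(3)] subseq_imp_subset[OF *(5)]
    unfolding lies_above_def by blast
  have "order_iso (xs @ ys) \<tau>"
    using order_iso_append[OF above, of \<sigma> \<rho>] * by (simp add: order_iso_def)
  moreover have "subseq (xs @ ys) (\<alpha> @ \<beta>)" using * by (intro list_emb_append_mono)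
  ultimately show "contains_pattern (\<alpha> @ \<beta>) \<tau>" unfolding contains_pattern_subseq by blast
qed

lemma order_iso_snoc:
  assumes "\<forall>x \<in> set xs. x < n"
  shows "order_iso (xs @ [n]) (ys @ [k]) \<longleftrightarrow> order_iso xs ys \<and> (\<forall>y \<in> set ys. y < k)"
proof (cases "length xs = length ys")
  case True
  then have zip: "zip (xs @ [n]) (ys @ [k]) = zip xs ys @ [(n, k)]" by simp
  have ys: "(\<forall>y \<in> set ys. y < k) \<longleftrightarrow> (\<forall>p \<in> set (zip xs ys). snd p < k)"
    using True by (metis in_set_impl_in_set_zip2 prod.collapse set_zip_rightD snd_conv)
  have "\<forall>p \<in> set (zip xs ys). fst p < n"
    using assms by (metis prod.collapse set_zip_leftD)
  then show ?thesis unfolding order_iso_def zip ys by (auto dest: less_asym)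
qed (simp add: order_iso_def)

lemma contains_pattern_snoc:
  assumes "\<forall>x \<in> set \<alpha>. x < n"
  shows "contains_pattern (\<alpha> @ [n]) \<tau> \<longleftrightarrow> contains_pattern \<alpha> \<tau> \<or>
    (\<exists>\<sigma> k. \<tau> = \<sigma> @ [k] \<and> (\<forall>y \<in> set \<sigma>. y < k) \<and> contains_pattern \<alpha> \<sigma>)"
proof
  assume "contains_pattern (\<alpha> @ [n]) \<tau>"
  then obtain xs ys where xy: "subseq xs \<alpha>" "subseq ys [n]" "order_iso (xs @ ys) \<tau>"
    unfolding contains_pattern_subseq by (metis subseq_appendE)
  have xs: "\<forall>x \<in> set xs. x < n" using subseq_imp_subset[OF xy(1)] assms by blast
  consider "ys = []" | "ys = [n]" using xy(2) by (cases ys) (auto split: if_splits)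
  then show "contains_pattern \<alpha> \<tau> \<or>
    (\<exists>\<sigma> k. \<tau> = \<sigma> @ [k] \<and> (\<forall>y \<in> set \<sigma>. y < k) \<and> contains_pattern \<alpha> \<sigma>)"
  proof cases
    case 1
    then show ?thesis using xy by (auto simp: contains_pattern_subseq)
  next
    case 2
    then have "\<tau> \<noteq> []" using xy(3) by (auto simp: order_iso_def)
    then obtain \<sigma> k where "\<tau> = \<sigma> @ [k]" by (metis append_butlast_last_id)
    with order_iso_snoc[OF xs, of \<sigma> k] xy 2 show ?thesis
      unfolding contains_pattern_subseq by blast
  qed
next
  assume *: "contains_pattern \<alpha> \<tau> \<or>
    (\<exists>\<sigma> k. \<tau> = \<sigma> @ [k] \<and> (\<forall>y \<in> set \<sigma>. y < k) \<and> contains_pattern \<alpha> \<sigma>)"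
  show "contains_pattern (\<alpha> @ [n]) \<tau>"
  proof (cases "contains_pattern \<alpha> \<tau>")
    case True
    then show ?thesis
      by (meson contains_pattern_trans subseq_imp_contains_pattern subseq_rev_drop_many subseq_order.order_refl)
  next
    case False
    with * obtain \<sigma> k xs where s: "\<tau> = \<sigma> @ [k]" "\<forall>y \<in> set \<sigma>. y < k" "subseq xs \<alpha>" "order_iso xs \<sigma>"
      by (auto simp: contains_pattern_subseq)
    have "\<forall>x \<in> set xs. x < n" using subseq_imp_subset[OF s(3)] assms by blast
    with s have "order_iso (xs @ [n]) \<tau>" by (simp add: order_iso_snoc)
    moreover have "subseq (xs @ [n]) (\<alpha> @ [n])" using s(3) by simp
    ultimately show ?thesis unfolding contains_pattern_subseq by blast
  qed
qed


section \<open>Decomposing 132-avoiding permutations at the maximum\<close>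

definition avoiders132 :: "nat \<Rightarrow> nat list set" where
  "avoiders132 n = {\<alpha> \<in> permutations_of_set {1..n}. \<not> contains_pattern \<alpha> [1, 3, 2]}"

text \<open>Both arguments stay normalised as permutations of an initial segment, so that each is
  counted independently; the shift restores the position of \<open>a\<close> above
  \<open>b\<close>.\<close>

definition glue :: "nat list \<Rightarrow> nat list \<Rightarrow> nat list" where
  "glue a b = map (\<lambda>x. x + length b) a @ Suc (length a + length b) # b"

lemma finite_avoiders132 [simp]: "finite (avoiders132 n)"
  by (simp add: avoiders132_def)

lemma avoiders132_0 [simp]: "avoiders132 0 = {[]}"
  by (auto simp: avoiders132_def)

lemma in_avoiders132_iff:
  "\<alpha> \<in> avoiders132 n \<longleftrightarrow> set \<alpha> = {1..n} \<and> length \<alpha> = n \<and> distinct \<alpha> \<and> \<not> contains_pattern \<alpha> [1, 3, 2]"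
  using distinct_card[of \<alpha>] by (auto simp: avoiders132_def permutations_of_set_def)

lemma contains_pattern_glue:
  assumes "set a = {1..length a}" "set b = {1..length b}"
  shows "contains_pattern (glue a b) \<tau> \<longleftrightarrow> (\<exists>\<sigma> \<rho>. \<tau> = \<sigma> @ \<rho> \<and> lies_above \<sigma> \<rho> \<and> contains_pattern b \<rho> \<and>
    (contains_pattern a \<sigma> \<or> (\<exists>\<pi> k. \<sigma> = \<pi> @ [k] \<and> (\<forall>y \<in> set \<pi>. y < k) \<and> contains_pattern a \<pi>)))"
proof -
  let ?a = "map (\<lambda>x. x + length b) a" and ?n = "Suc (length a + length b)"
  have "lies_above (?a @ [?n]) b" using assms by (auto simp: lies_above_def)
  from contains_pattern_append[OF this]
  have 1: "contains_pattern (glue a b) \<tau> \<longleftrightarrow> (\<exists>\<sigma> \<rho>. \<tau> = \<sigma> @ \<rho> \<and> lies_above \<sigma> \<rho> \<and>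
    contains_pattern (?a @ [?n]) \<sigma> \<and> contains_pattern b \<rho>)"
    by (simp add: glue_def)
  have "\<forall>x \<in> set ?a. x < ?n" using assms by auto
  from contains_pattern_snoc[OF this] show ?thesis unfolding 1
    by (auto simp: contains_pattern_map)
qed

text \<open>The pattern 132 cannot be cut, since its first entry is its smallest, and the maximum
  cannot finish it, since its last entry is not its largest. Hence an occurrence lies entirely in
  one of the two parts.\<close>

lemma contains_132_glue:
  assumes "set a = {1..length a}" "set b = {1..length b}"
  shows "contains_pattern (glue a b) [1, 3, 2] \<longleftrightarrow>
    contains_pattern a [1, 3, 2] \<or> contains_pattern b [1, 3, 2]"
proof -
  have split: "[1, 3, 2] = \<sigma> @ \<rho> \<and> lies_above \<sigma> \<rho> \<longleftrightarrow>
      \<sigma> = [] \<and> \<rho> = [1, 3, 2] \<or> \<sigma> = [1, 3, 2] \<and> \<rho> = []" for \<sigma> \<rho> :: "nat list"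
    by (auto simp: Cons_eq_append_conv lies_above_def)
  have snoc: "\<not> ([1, 3, 2] = \<pi> @ [k] \<and> (\<forall>y \<in> set \<pi>. y < k))" for \<pi> and k :: nat
    by (auto simp: Cons_eq_append_conv)
  show ?thesis unfolding contains_pattern_glue[OF assms]
    using split snoc by (smt (verit) contains_pattern_Nil append_is_Nil_conv not_Cons_self2)
qed

lemma glue_in_avoiders132:
  assumes "a \<in> avoiders132 k" "b \<in> avoiders132 l"
  shows "glue a b \<in> avoiders132 (Suc (k + l))"
proof -
  have a: "set a = {1..length a}" "length a = k" "distinct a" "\<not> contains_pattern a [1, 3, 2]"
   and b: "set b = {1..length b}" "length b = l" "distinct b" "\<not> contains_pattern b [1, 3, 2]"
    using assms by (auto simp: in_avoiders132_iff)
  have img: "(\<lambda>x. x + l) ` {1..k} = {Suc l..k + l}"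
    using image_add_atLeastAtMost'[of l 1 k] by (simp add: add.commute)
  have "set (glue a b) = {Suc l..k + l} \<union> {Suc (k + l)} \<union> {1..l}"
    using a(1,2) b(1,2) img by (auto simp: glue_def)
  also have "\<dots> = {1..Suc (k + l)}" by auto
  finally have "set (glue a b) = {1..Suc (k + l)}" .
  moreover have "distinct (glue a b)"
    using a b by (auto simp: glue_def distinct_map inj_on_def)
  moreover have "length (glue a b) = Suc (k + l)" using a b by (simp add: glue_def)
  moreover have "\<not> contains_pattern (glue a b) [1, 3, 2]"
    using a b contains_132_glue by blast
  ultimately show ?thesis by (simp add: in_avoiders132_iff)
qed

lemma avoiders132_Suc_cases:
  assumes "\<alpha> \<in> avoiders132 (Suc n)"
  obtains k a b where "k \<le> n" "a \<in> avoiders132 k" "b \<in> avoiders132 (n - k)" "\<alpha> = glue a b"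
proof -
  from assms have \<alpha>: "set \<alpha> = {1..Suc n}" "length \<alpha> = Suc n" "distinct \<alpha>"
    "\<not> contains_pattern \<alpha> [1, 3, 2]" by (auto simp: in_avoiders132_iff)
  then have "Suc n \<in> set \<alpha>" by simp
  then obtain c b where cb: "\<alpha> = c @ Suc n # b" by (meson split_list)
  let ?l = "length b"
  have dist: "distinct c" "distinct b" "set c \<inter> set b = {}" "Suc n \<notin> set c" "Suc n \<notin> set b"
    using \<alpha>(3) cb by auto
  have un: "set c \<union> set b = {1..n}"
  proof -
    have "insert (Suc n) (set c \<union> set b) = insert (Suc n) {1..n}"
      using \<alpha>(1) cb by (auto simp: atLeastAtMostSuc_conv)
    moreover have "Suc n \<notin> set c \<union> set b" "Suc n \<notin> {1..n}" using dist by auto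
    ultimately show ?thesis by (metis insert_ident)
  qed
  \<comment> \<open>Otherwise \<open>x\<close>, \<open>Suc n\<close>, \<open>y\<close> would form an
    occurrence of 132.\<close>
  have above: "y < x" if "x \<in> set c" "y \<in> set b" for x y
  proof (rule ccontr)
    assume "\<not> y < x"
    with that dist have "x < y" by (metis IntI empty_iff linorder_neqE_nat)
    moreover have "y < Suc n" using that un by (metis Un_iff atLeastAtMost_iff le_imp_less_Suc)
    ultimately have "order_iso [x, Suc n, y] [1, 3, 2]" by (auto simp: order_iso_def)
    moreover have "subseq ([x] @ ([Suc n] @ [y])) (c @ ([Suc n] @ b))"
      using that by (intro list_emb_append_mono) (auto simp: subseq_singleton_left)
    ultimately show False using \<alpha>(4) cb by (auto simp: contains_pattern_subseq)
  qed
  \<comment> \<open>No value below the maximum \<open>M\<close> of \<open>b\<close> can belong to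
    \<open>c\<close>, so \<open>b\<close> fills the segment up to \<open>M\<close>; distinctness
    identifies \<open>M\<close> with the length.\<close>
  have b: "set b = {1..?l}"
  proof (cases "b = []")
    case False
    define M where "M = Max (set b)"
    have M: "M \<in> set b" "\<And>x. x \<in> set b \<Longrightarrow> x \<le> M" using False by (simp_all add: M_def)
    have "set b = {1..M}"
    proof
      show "set b \<subseteq> {1..M}" using M un by auto
      show "{1..M} \<subseteq> set b"
      proof
        fix x assume x: "x \<in> {1..M}"
        moreover have "M \<le> n" using M un by auto
        ultimately have "x \<in> set c \<union> set b" using un by auto
        moreover have "x \<notin> set c" using above[OF _ M(1), of x] x by auto
        ultimately show "x \<in> set b" by blast
      qed
    qed
    with distinct_card[OF dist(2)] show ?thesis by simp
  qed simp
  have len: "length c + ?l = n" using \<alpha>(2) cb by simp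
  have c: "set c = {Suc ?l..n}"
  proof -
    have "set c = {1..n} - {1..?l}" using un dist(3) b by auto
    also have "\<dots> = {Suc ?l..n}" by auto
    finally show ?thesis .
  qed
  define a where "a = map (\<lambda>x. x - ?l) c"
  have ca: "c = map (\<lambda>x. x + ?l) a" unfolding a_def using c by (auto intro!: map_idI[symmetric])
  have "set a = (\<lambda>x. x - ?l) ` {Suc ?l..n}" by (simp add: a_def c)
  also have "\<dots> = {1..n - ?l}"
  proof (intro equalityI subsetI)
    fix x assume "x \<in> {1..n - ?l}"
    then show "x \<in> (\<lambda>x. x - ?l) ` {Suc ?l..n}" by (intro image_eqI[of _ _ "x + ?l"]) auto
  qed auto
  finally have seta: "set a = {1..n - ?l}" .
  have lena: "length a = n - ?l" using len by (simp add: a_def)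
  have dista: "distinct a" using dist(1) ca by (simp add: distinct_map)
  have glue: "\<alpha> = glue a b"
    unfolding glue_def ca[symmetric] using cb len lena by simp
  have "\<not> contains_pattern (glue a b) [1, 3, 2]" using \<alpha>(4) glue by simp
  then have "\<not> contains_pattern a [1, 3, 2]" "\<not> contains_pattern b [1, 3, 2]"
    using contains_132_glue[of a b] seta lena b by auto
  with seta lena dista b dist have "a \<in> avoiders132 (n - ?l)" "b \<in> avoiders132 ?l"
    by (auto simp: in_avoiders132_iff)
  with glue len show thesis by (intro that[of "n - ?l"]) auto
qed

text \<open>The value \<open>Suc n\<close> occurs only once, so its position recovers the two sides;
  knowing \<open>b\<close>, the shift of \<open>a\<close> can be undone.\<close>

lemma inj_on_glue:
  "inj_on (\<lambda>(k, a, b). glue a b) (SIGMA k:{0..n}. avoiders132 k \<times> avoiders132 (n - k))"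
proof (rule inj_onI, clarsimp)
  fix k a b k' a' b'
  assume k: "k \<le> n" "k' \<le> n"
    and a: "a \<in> avoiders132 k" and b: "b \<in> avoiders132 (n - k)"
    and a': "a' \<in> avoiders132 k'" and b': "b' \<in> avoiders132 (n - k')"
    and eq: "glue a b = glue a' b'"
  have len: "length a = k" "length b = n - k" "length a' = k'" "length b' = n - k'"
    using a b a' b' by (auto simp: in_avoiders132_iff)
  have eq': "map (\<lambda>x. x + length b) a @ Suc n # b = map (\<lambda>x. x + length b') a' @ Suc n # b'"
    using eq k len by (simp add: glue_def)
  have notin: "Suc n \<notin> set (map (\<lambda>x. x + length b) a)" "Suc n \<notin> set b"
    using a b k len by (auto simp: in_avoiders132_iff)
  from append_Cons_eq_iff[OF notin, of _ b'] eq'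
  have eqs: "map (\<lambda>x. x + length b) a = map (\<lambda>x. x + length b') a'" "b = b'" by auto
  then have "a = a'" by (simp add: inj_map_eq_map inj_on_def)
  with eqs(2) len show "k = k' \<and> a = a' \<and> b = b'" by simp
qed

lemma bij_betw_glue:
  "bij_betw (\<lambda>(k, a, b). glue a b)
     (SIGMA k:{0..n}. avoiders132 k \<times> avoiders132 (n - k)) (avoiders132 (Suc n))"
  unfolding bij_betw_def
proof (intro conjI inj_on_glue equalityI subsetI)
  fix \<alpha> assume "\<alpha> \<in> (\<lambda>(k, a, b). glue a b) ` (SIGMA k:{0..n}. avoiders132 k \<times> avoiders132 (n - k))"
  then show "\<alpha> \<in> avoiders132 (Suc n)" using glue_in_avoiders132 by fastforce
next
  fix \<alpha> assume "\<alpha> \<in> avoiders132 (Suc n)"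
  then show "\<alpha> \<in> (\<lambda>(k, a, b). glue a b) ` (SIGMA k:{0..n}. avoiders132 k \<times> avoiders132 (n - k))"
    by (rule avoiders132_Suc_cases) force
qed


section \<open>Weighted generating functions\<close>

text \<open>Real weights, not just counts, are allowed because the recurrence below needs
  differences of avoidance indicators.\<close>

definition weight_gf :: "(nat list \<Rightarrow> real) \<Rightarrow> real fps" where
  "weight_gf w = Abs_fps (\<lambda>n. \<Sum>\<alpha>\<in>avoiders132 n. w \<alpha>)"

definition avoids :: "nat list \<Rightarrow> nat list \<Rightarrow> real" where
  "avoids \<tau> \<alpha> = of_bool (\<not> contains_pattern \<alpha> \<tau>)"

lemma avoiding_gf_eq_weight_gf: "avoiding_gf \<tau> = weight_gf (avoids \<tau>)"
proof (rule fps_ext)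
  fix n
  have "{\<alpha> \<in> permutations_of_set {1..n}. \<not> contains_pattern \<alpha> [1, 3, 2] \<and> \<not> contains_pattern \<alpha> \<tau>} =
      avoiders132 n \<inter> {\<alpha>. \<not> contains_pattern \<alpha> \<tau>}"
    by (auto simp: avoiders132_def)
  then show "avoiding_gf \<tau> $ n = weight_gf (avoids \<tau>) $ n"
    by (simp add: avoiding_gf_def weight_gf_def count_avoiding_def avoids_def)
qed

lemma weight_gf_diff: "weight_gf (\<lambda>\<alpha>. u \<alpha> - v \<alpha>) = weight_gf u - weight_gf v"
  by (rule fps_ext) (simp add: weight_gf_def sum_subtractf)

text \<open>If the weight of a glued permutation is a sum of products, summing over the length of
  \<open>a\<close> produces Cauchy products. The factor \<open>fps_X\<close> accounts for the
  maximum and the constant term for the empty permutation.\<close>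

lemma weight_gf_glue:
  assumes "\<And>k l a b. a \<in> avoiders132 k \<Longrightarrow> b \<in> avoiders132 l \<Longrightarrow>
    w (glue a b) = (\<Sum>j\<in>J. u j a * v j b)"
  shows "weight_gf w = fps_const (w []) + fps_X * (\<Sum>j\<in>J. weight_gf (u j) * weight_gf (v j))"
proof (rule fps_ext)
  fix n
  show "weight_gf w $ n =
    (fps_const (w []) + fps_X * (\<Sum>j\<in>J. weight_gf (u j) * weight_gf (v j))) $ n"
  proof (cases n)
    case 0
    then show ?thesis by (simp add: weight_gf_def)
  next
    case (Suc n)
    have "(\<Sum>\<alpha>\<in>avoiders132 (Suc n). w \<alpha>) =
        (\<Sum>(k, a, b)\<in>(SIGMA k:{0..n}. avoiders132 k \<times> avoiders132 (n - k)). w (glue a b))"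
      by (subst sum.reindex_bij_betw[OF bij_betw_glue, symmetric]) (simp add: case_prod_unfold)
    also have "\<dots> = (\<Sum>k=0..n. \<Sum>a\<in>avoiders132 k. \<Sum>b\<in>avoiders132 (n - k). w (glue a b))"
      by (subst sum.Sigma[symmetric]) (auto simp: sum.cartesian_product)
    also have "\<dots> = (\<Sum>k=0..n. \<Sum>a\<in>avoiders132 k. \<Sum>b\<in>avoiders132 (n - k). \<Sum>j\<in>J. u j a * v j b)"
      by (intro sum.cong refl assms)
    also have "\<dots> = (\<Sum>k=0..n. \<Sum>j\<in>J. \<Sum>a\<in>avoiders132 k. \<Sum>b\<in>avoiders132 (n - k). u j a * v j b)"
      by (simp only: sum.swap[of _ _ J])
    also have "\<dots> = (\<Sum>j\<in>J. \<Sum>k=0..n. (\<Sum>a\<in>avoiders132 k. u j a) * (\<Sum>b\<in>avoiders132 (n - k). v j b))"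
      by (subst sum.swap) (simp add: sum_product)
    finally show ?thesis
      unfolding Suc fps_add_nth fps_X_mult_nth by (simp add: weight_gf_def fps_sum_nth fps_mult_nth)
  qed
qed

section \<open>Increasing patterns and the functions R\<close>

lemma avoiding_gf_cong:
  assumes "\<And>\<alpha>. contains_pattern \<alpha> \<tau> \<longleftrightarrow> contains_pattern \<alpha> \<tau>'"
  shows "avoiding_gf \<tau> = avoiding_gf \<tau>'"
  by (simp add: avoiding_gf_def count_avoiding_def assms)

lemma avoiding_gf_Nil [simp]: "avoiding_gf [] = 0"
  by (rule fps_ext) (simp add: avoiding_gf_def count_avoiding_def)

lemma avoiding_gf_shift: "avoiding_gf (map (\<lambda>x. x + c) \<tau>) = avoiding_gf \<tau>"
  by (rule avoiding_gf_cong) (simp add: contains_pattern_map)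

lemma map_add_right_upt: "map (\<lambda>x. x + c) [i..<j] = [i + c..<j + c]"
  by (induction j) auto

text \<open>A cut into two nonempty parts with the first one above would create a descent.\<close>

lemma upt_append_lies_above:
  assumes "[i..<j] = \<sigma> @ \<rho>" "lies_above \<sigma> \<rho>"
  shows "\<sigma> = [] \<or> \<rho> = []"
proof (rule ccontr)
  assume ne: "\<not> ?thesis"
  have "sorted (\<sigma> @ \<rho>)" by (metis assms(1) sorted_upt)
  then have "hd \<sigma> \<le> hd \<rho>" using ne by (auto simp: sorted_append)
  moreover have "hd \<rho> < hd \<sigma>" using ne assms(2) by (simp add: lies_above_def)
  ultimately show False by simp
qed

text \<open>An increasing pattern cannot be cut, so it occurs either in \<open>b\<close> or in
  front, where the maximum may supply its last entry. Hence \<open>a\<close> only has to contain the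
  pattern that is shorter by one.\<close>

lemma avoids_increasing_glue:
  assumes "a \<in> avoiders132 k" "b \<in> avoiders132 l"
  shows "avoids [Suc 0..<Suc (Suc p)] (glue a b) = avoids [Suc 0..<Suc p] a * avoids [Suc 0..<Suc (Suc p)] b"
proof -
  let ?t = "[Suc 0..<Suc (Suc p)]"
  have t: "?t = [Suc 0..<Suc p] @ [Suc p]" by simp
  have split: "?t = \<sigma> @ \<rho> \<and> lies_above \<sigma> \<rho> \<longleftrightarrow> \<sigma> = [] \<and> \<rho> = ?t \<or> \<sigma> = ?t \<and> \<rho> = []" for \<sigma> \<rho>
    using upt_append_lies_above[of "Suc 0" "Suc (Suc p)" \<sigma> \<rho>]
    by (auto simp: lies_above_def simp del: upt_Suc)
  have snoc: "?t = \<pi> @ [k] \<and> (\<forall>y \<in> set \<pi>. y < k) \<longleftrightarrow> \<pi> = [Suc 0..<Suc p] \<and> k = Suc p" for \<pi> k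
    unfolding t by auto
  have "contains_pattern a [Suc 0..<Suc p]" if "contains_pattern a ?t"
    using that contains_pattern_trans subseq_imp_contains_pattern t
    by (metis subseq_rev_drop_many subseq_order.order_refl)
  then have mono: "contains_pattern a ?t \<or> contains_pattern a [Suc 0..<Suc p] \<longleftrightarrow>
      contains_pattern a [Suc 0..<Suc p]" by blast
  \<comment> \<open>The bracketing of the conjunction under the quantifier is chosen so that
    \<open>snoc\<close> rewrites it.\<close>
  define D where "D \<sigma> \<longleftrightarrow> contains_pattern a \<sigma> \<or>
    (\<exists>\<pi> k. (\<sigma> = \<pi> @ [k] \<and> (\<forall>y \<in> set \<pi>. y < k)) \<and> contains_pattern a \<pi>)" for \<sigma>
  have D: "D []" "D ?t \<longleftrightarrow> contains_pattern a [Suc 0..<Suc p]"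
    unfolding D_def snoc using mono by auto
  have "contains_pattern (glue a b) ?t \<longleftrightarrow>
      (\<exists>\<sigma> \<rho>. (?t = \<sigma> @ \<rho> \<and> lies_above \<sigma> \<rho>) \<and> contains_pattern b \<rho> \<and> D \<sigma>)"
    using contains_pattern_glue[of a b ?t] assms by (simp add: in_avoiders132_iff D_def del: upt_Suc)
  also have "\<dots> \<longleftrightarrow> contains_pattern a [Suc 0..<Suc p] \<or> contains_pattern b ?t"
    unfolding split using D contains_pattern_Nil by blast
  finally show ?thesis by (simp add: avoids_def del: upt_Suc)
qed

text \<open>The decomposition gives F = 1 + x R F with R the series for length \<open>p\<close>,
  which is the recursion \<open>cheb_R_Suc\<close>. For length 0 the empty pattern occurs everywhere
  and both sides vanish.\<close>

lemma avoiding_gf_increasing: "avoiding_gf [Suc 0..<Suc p] = cheb_R p"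
proof (induction p)
  case 0
  show ?case by (simp add: cheb_R_0)
next
  case (Suc p)
  let ?F = "avoiding_gf [Suc 0..<Suc (Suc p)]" and ?R = "cheb_R p"
  \<comment> \<open>A single product suffices here, so the index set is a singleton.\<close>
  have "?F = fps_const (avoids [Suc 0..<Suc (Suc p)] []) + fps_X * (\<Sum>j\<in>{0::nat}.
      weight_gf (avoids [Suc 0..<Suc p]) * weight_gf (avoids [Suc 0..<Suc (Suc p)]))"
    unfolding avoiding_gf_eq_weight_gf
    by (rule weight_gf_glue) (simp add: avoids_increasing_glue del: upt_Suc)
  also have "\<dots> = 1 + fps_X * (?R * ?F)"
    using Suc by (simp add: avoids_def flip: avoiding_gf_eq_weight_gf)
  finally have F: "?F = 1 + fps_X * (?R * ?F)" .
  have "(1 - fps_X * ?R) * ?F = ?F - fps_X * (?R * ?F)" by (simp only: left_diff_distrib mult_1 mult.assoc)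
  also have "\<dots> = 1" by (subst (1) F) simp
  finally have "inverse (1 - fps_X * ?R) = ?F" by (rule fps_inverse_unique)
  then show ?case by (simp only: cheb_R_Suc)
qed


section \<open>Layered patterns\<close>

text \<open>With endpoints given by a function, any run of consecutive blocks is expressible and
  splits at each boundary; no endpoint 0 is appended, the last one being \<open>m j\<close>.\<close>

definition blocks :: "(nat \<Rightarrow> nat) \<Rightarrow> nat \<Rightarrow> nat \<Rightarrow> nat list" where
  "blocks m i j = concat (map (\<lambda>l. [Suc (m (Suc l))..<Suc (m l)]) [i..<j])"

lemma blocks_same [simp]: "blocks m i i = []"
  by (simp add: blocks_def)

lemma blocks_Cons: "i < j \<Longrightarrow> blocks m i j = [Suc (m (Suc i))..<Suc (m i)] @ blocks m (Suc i) j"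
  by (simp add: blocks_def upt_conv_Cons)

lemma blocks_append:
  assumes "i \<le> j" "j \<le> k"
  shows "blocks m i k = blocks m i j @ blocks m j k"
proof -
  have "[i..<k] = [i..<j] @ [j..<k]" using assms by (metis le_Suc_ex upt_add_eq_append)
  then show ?thesis by (simp add: blocks_def)
qed

text \<open>The hypothesis \<open>m j = 0\<close> supplies the endpoint that \<open>layered\<close>
  appends. The listed endpoints \<open>f\<close> may differ from \<open>m\<close> outside the range,
  so \<open>m\<close> can be altered at \<open>j\<close>.\<close>

lemma layered_eq_blocks:
  assumes "\<And>l. i \<le> l \<Longrightarrow> l < j \<Longrightarrow> f l = m l" "m j = 0" "i \<le> j"
  shows "layered (map f [i..<j]) = blocks m i j"
proof -
  have nth: "(map f [i..<j] @ [0]) ! l = m (l + i)" if "l \<le> j - i" for l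
    using that assms by (auto simp: nth_append add.commute)
  have "[i..<j] = map (\<lambda>l. l + i) [0..<j - i]" using assms by (simp add: map_add_upt)
  then have "blocks m i j = concat (map (\<lambda>l. [Suc (m (Suc l + i))..<Suc (m (l + i))]) [0..<j - i])"
    by (simp add: blocks_def o_def)
  also have "\<dots> = layered (map f [i..<j])"
    unfolding layered_def using nth
    by (intro arg_cong[of _ _ concat]) (auto simp del: upt_Suc intro!: map_cong)
  finally show ?thesis by simp
qed

lemma decreasing_between:
  fixes m :: "nat \<Rightarrow> nat"
  assumes "i \<le> l" "l \<le> j" "\<And>l. i \<le> l \<Longrightarrow> l < j \<Longrightarrow> m (Suc l) < m l"
  shows "m j \<le> m l"
  using assms(2,1)
proof (induction l rule: inc_induct)
  case (step l)
  then have "m j \<le> m (Suc l)" "m (Suc l) < m l" using assms(3) by auto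
  then show ?case by simp
qed simp

lemma blocks_bounds:
  assumes "\<And>l. i \<le> l \<Longrightarrow> l < j \<Longrightarrow> m (Suc l) < m l" "x \<in> set (blocks m i j)"
  shows "m j < x \<and> x \<le> m i"
proof -
  have anti: "m l' \<le> m l" if "i \<le> l" "l \<le> l'" "l' \<le> j" for l l'
    by (rule decreasing_between[OF _ that(2)]) (use that assms(1) in auto)
  from assms(2) obtain l where l: "i \<le> l" "l < j" "x \<in> {Suc (m (Suc l))..<Suc (m l)}"
    by (auto simp: blocks_def)
  with anti[of i l] anti[of "Suc l" j] show ?thesis by auto
qed

lemma lies_above_blocks:
  assumes "\<And>l. i \<le> l \<Longrightarrow> l < k \<Longrightarrow> m (Suc l) < m l" "i \<le> j" "j \<le> k"
  shows "lies_above (blocks m i j) (blocks m j k)"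
  using blocks_bounds[of i j m] blocks_bounds[of j k m] assms unfolding lies_above_def
  by (meson le_trans less_le_trans order_le_less_trans)

text \<open>A cut inside the first block is forced to one of its ends, because the block is
  increasing; a later cut is handled by induction on the remaining blocks.\<close>

lemma blocks_eq_append_lies_above:
  assumes "i \<le> N" "blocks m i N = \<sigma> @ \<rho>" "lies_above \<sigma> \<rho>"
  shows "\<exists>j. i \<le> j \<and> j \<le> N \<and> \<sigma> = blocks m i j \<and> \<rho> = blocks m j N"
  using assms
proof (induction i arbitrary: \<sigma> rule: inc_induct)
  case (step i)
  let ?B = "[Suc (m (Suc i))..<Suc (m i)]"
  have eq: "?B @ blocks m (Suc i) N = \<sigma> @ \<rho>"
    using step.prems(1) blocks_Cons[OF step.hyps(2), of m] by (simp del: upt_Suc)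
  then consider us where "?B = \<sigma> @ us" "us @ blocks m (Suc i) N = \<rho>"
    | us where "?B @ us = \<sigma>" "blocks m (Suc i) N = us @ \<rho>"
    by (auto simp: append_eq_append_conv2 simp del: upt_Suc)
  then show ?case
  proof cases
    case 1
    then have "lies_above \<sigma> us" using step.prems(2) by (auto simp: lies_above_def)
    from upt_append_lies_above[OF 1(1) this] show ?thesis
    proof
      assume "\<sigma> = []"
      then show ?thesis using step.hyps step.prems by (intro exI[of _ i]) simp
    next
      assume "us = []"
      then show ?thesis using step.hyps step.prems 1 blocks_Cons[of i "Suc i" m]
        by (intro exI[of _ "Suc i"]) (simp del: upt_Suc)
    qed
  next
    case 2
    have "lies_above us \<rho>" using step.prems(2) 2(1) by (auto simp: lies_above_def)
    from step.IH[OF 2(2) this] obtain j where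
      j: "Suc i \<le> j" "j \<le> N" "us = blocks m (Suc i) j" "\<rho> = blocks m j N" by blast
    then show ?thesis using 2(1) blocks_Cons[of i j m] by (intro exI[of _ j]) (auto simp del: upt_Suc)
  qed
qed (auto simp: lies_above_def)

text \<open>
  The part of the first \<^term>\<open>j\<close> blocks that has to occur in front of the maximum of the
  permutation: if \<open>j = 1\<close>, the maximum itself can play the role of the last entry of the block.
\<close>

definition head_pattern :: "(nat \<Rightarrow> nat) \<Rightarrow> nat \<Rightarrow> nat list" where
  "head_pattern m j = (if j = 1 then [Suc (m 1)..<m 0] else blocks m 0 j)"

lemma head_pattern_0 [simp]: "head_pattern m 0 = []"
  by (simp add: head_pattern_def)

text \<open>Each head pattern is a prefix of the later ones. The index 1 needs separate treatment,
  because there the last entry of the block is dropped.\<close>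

lemma head_pattern_mono:
  assumes "m 1 < m 0" "i \<le> j" "contains_pattern a (head_pattern m j)"
  shows "contains_pattern a (head_pattern m i)"
proof -
  have pre: "subseq xs (xs @ ys)" for xs ys :: "nat list"
    by (simp add: subseq_rev_drop_many)
  have block: "blocks m 0 1 = head_pattern m 1 @ [m 0]"
    using assms(1) by (simp add: blocks_def head_pattern_def)
  have "subseq (head_pattern m i) (head_pattern m j)"
  proof (cases "i = j \<or> i = 0")
    case True
    then show ?thesis by auto
  next
    case False
    then have "1 \<le> i" "i \<le> j" "j \<noteq> 1" using assms(2) by auto
    then have "head_pattern m j = blocks m 0 i @ blocks m i j"
      using blocks_append[of 0 i j m] by (simp add: head_pattern_def)
    moreover have "subseq (head_pattern m i) (blocks m 0 i)"
      using block pre by (cases "i = 1") (auto simp: head_pattern_def)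
    ultimately show ?thesis using pre by (metis subseq_order.order_trans)
  qed
  with assms(3) show ?thesis using contains_pattern_trans subseq_imp_contains_pattern by blast
qed

text \<open>For \<open>j = 1\<close> the last entry \<open>m 0\<close> is the largest and the
  maximum can play it. For \<open>j \<ge> 2\<close> the last entry belongs to a lower block than
  \<open>m 0\<close>, so the maximum is of no help.\<close>

lemma head_pattern_iff:
  assumes dec: "\<And>l. l < j \<Longrightarrow> m (Suc l) < m l"
  shows "contains_pattern a (blocks m 0 j) \<or>
      (\<exists>\<pi> k. blocks m 0 j = \<pi> @ [k] \<and> (\<forall>y \<in> set \<pi>. y < k) \<and> contains_pattern a \<pi>)
    \<longleftrightarrow> contains_pattern a (head_pattern m j)"
proof (cases "j = 1")
  case True
  then have eq: "blocks m 0 j = head_pattern m 1 @ [m 0]"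
    using dec[of 0] by (simp add: blocks_def head_pattern_def)
  moreover have "\<forall>y \<in> set (head_pattern m 1). y < m 0" by (simp add: head_pattern_def)
  moreover have "contains_pattern a (head_pattern m 1)" if "contains_pattern a (head_pattern m 1 @ [m 0])"
    using that contains_pattern_trans subseq_imp_contains_pattern
    by (metis subseq_rev_drop_many subseq_order.order_refl)
  ultimately show ?thesis using True by auto
next
  case False
  have "\<not> (\<forall>y \<in> set \<pi>. y < k)" if eq: "blocks m 0 j = \<pi> @ [k]" for \<pi> k
  proof
    assume less: "\<forall>y \<in> set \<pi>. y < k"
    have "j \<noteq> 0" using eq by (cases j) auto
    with False have j: "2 \<le> j" by simp
    have "blocks m 0 j = blocks m 0 (j - 1) @ blocks m (j - 1) j" by (rule blocks_append) (use j in auto)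
    moreover have "lies_above (blocks m 0 (j - 1)) (blocks m (j - 1) j)"
      by (rule lies_above_blocks) (use j dec in auto)
    moreover have ne: "m 0 \<in> set (blocks m 0 (j - 1))"
      using blocks_Cons[of 0 "j - 1" m] j dec[of 0] by simp
    moreover have "m (j - 1) \<in> set (blocks m (j - 1) j)"
      using blocks_Cons[of "j - 1" j m] j dec[of "j - 1"] by simp
    ultimately have k: "k \<in> set (blocks m (j - 1) j)"
      using eq by (metis append_is_Nil_conv empty_iff empty_set last_appendR last_in_set last_snoc)
    have "m 0 \<noteq> k" "k < m 0"
      using k ne \<open>lies_above _ _\<close> by (auto simp: lies_above_def)
    moreover have "m 0 \<in> set (\<pi> @ [k])"
      unfolding eq[symmetric] using ne \<open>blocks m 0 j = blocks m 0 (j - 1) @ _\<close> by simp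
    ultimately show False using less by auto
  qed
  then show ?thesis using False by (auto simp: head_pattern_def)
qed

section \<open>The recurrence for layered patterns\<close>

lemma contains_blocks_glue:
  assumes dec: "\<And>l. l < N \<Longrightarrow> m (Suc l) < m l"
    and ab: "a \<in> avoiders132 k" "b \<in> avoiders132 l"
  shows "contains_pattern (glue a b) (blocks m 0 N) \<longleftrightarrow>
    (\<exists>j\<le>N. contains_pattern a (head_pattern m j) \<and> contains_pattern b (blocks m j N))"
    (is "?L \<longleftrightarrow> ?R")
proof -
  have split: "blocks m 0 N = \<sigma> @ \<rho> \<and> lies_above \<sigma> \<rho> \<longleftrightarrow>
      (\<exists>j\<le>N. \<sigma> = blocks m 0 j \<and> \<rho> = blocks m j N)" for \<sigma> \<rho>
  proof
    show "\<exists>j\<le>N. \<sigma> = blocks m 0 j \<and> \<rho> = blocks m j N" if "blocks m 0 N = \<sigma> @ \<rho> \<and> lies_above \<sigma> \<rho>"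
      using blocks_eq_append_lies_above[of 0 N m \<sigma> \<rho>] that by auto
  next
    assume "\<exists>j\<le>N. \<sigma> = blocks m 0 j \<and> \<rho> = blocks m j N"
    then obtain j where j: "j \<le> N" "\<sigma> = blocks m 0 j" "\<rho> = blocks m j N" by blast
    have "lies_above (blocks m 0 j) (blocks m j N)" by (rule lies_above_blocks) (use dec j in auto)
    then show "blocks m 0 N = \<sigma> @ \<rho> \<and> lies_above \<sigma> \<rho>" using j blocks_append[of 0 j N m] by simp
  qed
  have "?L \<longleftrightarrow> (\<exists>\<sigma> \<rho>. (blocks m 0 N = \<sigma> @ \<rho> \<and> lies_above \<sigma> \<rho>) \<and> contains_pattern b \<rho> \<and>
    (contains_pattern a \<sigma> \<or> (\<exists>\<pi> k. \<sigma> = \<pi> @ [k] \<and> (\<forall>y \<in> set \<pi>. y < k) \<and> contains_pattern a \<pi>)))"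
    using contains_pattern_glue[of a b] ab by (simp add: in_avoiders132_iff conj_assoc)
  also have "\<dots> \<longleftrightarrow> (\<exists>j\<le>N. contains_pattern b (blocks m j N) \<and>
     (contains_pattern a (blocks m 0 j) \<or>
      (\<exists>\<pi> k. blocks m 0 j = \<pi> @ [k] \<and> (\<forall>y \<in> set \<pi>. y < k) \<and> contains_pattern a \<pi>)))"
    unfolding split by blast
  also have "\<dots> \<longleftrightarrow> ?R"
  proof -
    have "contains_pattern a (blocks m 0 j) \<or>
        (\<exists>\<pi> k. blocks m 0 j = \<pi> @ [k] \<and> (\<forall>y \<in> set \<pi>. y < k) \<and> contains_pattern a \<pi>)
      \<longleftrightarrow> contains_pattern a (head_pattern m j)" if "j \<le> N" for j
      by (rule head_pattern_iff) (use that dec in auto)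
    then show ?thesis by blast
  qed
  finally show ?thesis .
qed

text \<open>If \<open>P N\<close> holds, exactly one difference is nonzero, at the \<open>j\<close>
  where \<open>P\<close> switches from false to true. Up to this \<open>j\<close> the condition
  demands \<open>S\<close>, whose strongest instance is \<open>S j\<close> itself; beyond it
  \<open>P\<close> already holds.\<close>

lemma of_bool_chain_sum:
  fixes P S :: "nat \<Rightarrow> bool"
  assumes "\<not> P 0" "\<And>i j. i \<le> j \<Longrightarrow> P i \<Longrightarrow> P j" "\<And>i j. i \<le> j \<Longrightarrow> j < N \<Longrightarrow> S j \<Longrightarrow> S i"
  shows "(of_bool ((\<forall>j<N. P j \<or> S j) \<and> P N) :: real) =
    (\<Sum>j<N. (of_bool (P (Suc j)) - of_bool (P j)) * of_bool (S j))"
  using assms(3)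
proof (induction N)
  case 0
  then show ?case using assms by simp
next
  case (Suc N)
  have IH: "(of_bool ((\<forall>j<N. P j \<or> S j) \<and> P N) :: real) =
    (\<Sum>j<N. (of_bool (P (Suc j)) - of_bool (P j)) * of_bool (S j))"
    by (rule Suc.IH) (use Suc.prems in auto)
  have "P N \<Longrightarrow> P (Suc N)" using assms(2)[of N "Suc N"] by simp
  moreover have "\<forall>j<N. P j \<or> S j" if "S N" using Suc.prems[of _ N] that by auto
  ultimately show ?case unfolding sum.lessThan_Suc IH[symmetric]
    by (auto simp: less_Suc_eq)
qed

lemma layered_gf_recurrence:
  assumes dec: "\<And>l. l < N \<Longrightarrow> m (Suc l) < m l" and N: "2 \<le> N"
  shows "avoiding_gf (blocks m 0 N) = 1 + fps_X * (\<Sum>j<N.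
    (avoiding_gf (head_pattern m (Suc j)) - avoiding_gf (head_pattern m j)) * avoiding_gf (blocks m j N))"
proof -
  have "blocks m 0 N \<noteq> []" using blocks_Cons[of 0 N m] dec[of 0] N by simp
  then have Nil: "avoids (blocks m 0 N) [] = 1" by (simp add: avoids_def)
  have "weight_gf (avoids (blocks m 0 N)) = fps_const (avoids (blocks m 0 N) []) + fps_X * (\<Sum>j<N.
    weight_gf (\<lambda>a. avoids (head_pattern m (Suc j)) a - avoids (head_pattern m j) a) *
    weight_gf (avoids (blocks m j N)))"
  proof (rule weight_gf_glue)
    fix k l a b assume ab: "a \<in> avoiders132 k" "b \<in> avoiders132 l"
    let ?P = "\<lambda>j. \<not> contains_pattern a (head_pattern m j)"
    let ?S = "\<lambda>j. \<not> contains_pattern b (blocks m j N)"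
    have S: "?S i" if "i \<le> j" "j < N" "?S j" for i j
    proof -
      have "subseq (blocks m j N) (blocks m i N)"
        using blocks_append[of i j N m] that by (simp add: subseq_drop_many)
      then show ?thesis using that contains_pattern_trans subseq_imp_contains_pattern by blast
    qed
    \<comment> \<open>For \<open>j = N\<close> no blocks are left for \<open>b\<close>, and the
      empty pattern is always contained, which leaves the bare condition
      \<open>?P N\<close>.\<close>
    have "(\<not> contains_pattern (glue a b) (blocks m 0 N)) = ((\<forall>j<N. ?P j \<or> ?S j) \<and> ?P N)"
      using contains_blocks_glue[where N = N and m = m, OF dec ab] by (auto simp: le_less)
    moreover have "(of_bool ((\<forall>j<N. ?P j \<or> ?S j) \<and> ?P N) :: real) =
        (\<Sum>j<N. (of_bool (?P (Suc j)) - of_bool (?P j)) * of_bool (?S j))"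
      by (rule of_bool_chain_sum) (use S head_pattern_mono[of m _ _ a] dec[of 0] N in auto)
    ultimately show "avoids (blocks m 0 N) (glue a b) =
      (\<Sum>j<N. (avoids (head_pattern m (Suc j)) a - avoids (head_pattern m j) a) * avoids (blocks m j N) b)"
      unfolding avoids_def by simp
  qed
  then show ?thesis by (simp add: Nil weight_gf_diff avoiding_gf_eq_weight_gf)
qed

text \<open>The contributions of \<open>P 1\<close> and \<open>P (Suc r)\<close> are kept outside
  the sum: in the application the first is a function R and the second is the unknown series
  itself.\<close>

lemma summation_by_parts:
  fixes P S :: "nat \<Rightarrow> 'a :: comm_ring_1"
  assumes "1 \<le> r" "P 0 = 0"
  shows "(\<Sum>j<Suc r. (P (Suc j) - P j) * S j) =
    P 1 * S 0 + P (Suc r) * S r - P 1 * S 1 + (\<Sum>j = 2..r. P j * (S (j - 1) - S j))"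
  using assms(1)
proof (induction r rule: dec_induct)
  case base
  then show ?case using assms(2) by (simp add: algebra_simps numeral_2_eq_2)
next
  case (step r)
  then show ?case by (simp add: algebra_simps)
qed

theorem theorem2p3:
  fixes r :: nat and m :: "nat \<Rightarrow> nat"
  assumes "1 \<le> r"
    and "\<And>i. i < r \<Longrightarrow> m (Suc i) < m i"
    and "0 < m r"
  shows "(1 - fps_X * cheb_R (m 0 - m 1 - 1) - fps_X * cheb_R (m r))
           * layered_gf (map m [0..<Suc r]) =
         1 - fps_X * cheb_R (m 0 - m 1 - 1) * layered_gf (map m [1..<Suc r])
           + fps_X * (\<Sum>j = 2..r. layered_gf (map (\<lambda>i. m i - m j) [0..<j])
               * (layered_gf (map m [j - 1..<Suc r]) - layered_gf (map m [j..<Suc r])))"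
proof -
  \<comment> \<open>The value \<open>m (Suc r)\<close> is unconstrained, so it is replaced by the
    final endpoint 0; this also makes the last block nonempty, as \<open>0 < m r\<close>.\<close>
  define M where "M = m(Suc r := 0)"
  have M: "M l = m l" if "l \<le> r" for l using that by (simp add: M_def)
  have dec: "M (Suc l) < M l" if "l < Suc r" for l
    using that assms(2,3) by (cases "l = r") (auto simp: M_def)
  define P where "P j = avoiding_gf (head_pattern M j)" for j
  define S where "S j = avoiding_gf (blocks M j (Suc r))" for j
  have S_eq: "layered_gf (map m [i..<Suc r]) = S i" if "i \<le> Suc r" for i
    unfolding S_def using that by (subst layered_eq_blocks[of _ _ m M]) (auto simp: M_def)
  have S1: "layered_gf (map m [1..<Suc r]) = S 1" by (rule S_eq) simp
  \<comment> \<open>There are at least two blocks, so the exceptional clause of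
    \<open>head_pattern\<close> does not apply. This is where the unknown series enters the
    right-hand side of the recurrence.\<close>
  have S0: "S 0 = P (Suc r)" using assms(1) by (simp add: S_def P_def head_pattern_def)
  have P0: "P 0 = 0" by (simp add: P_def)
  have Sr: "S r = cheb_R (m r)"
    unfolding S_def using blocks_Cons[of r "Suc r" M] avoiding_gf_increasing[of "m r"]
    by (simp add: M_def del: upt_Suc)
  \<comment> \<open>The block has \<open>m 0 - m 1\<close> entries, and the permutation's maximum
    takes over one of them.\<close>
  have P1: "P 1 = cheb_R (m 0 - m 1 - 1)"
  proof -
    have less: "m 1 < m 0" using assms(1) assms(2)[of 0] by simp
    have "head_pattern M 1 = map (\<lambda>x. x + m 1) [Suc 0..<Suc (m 0 - m 1 - 1)]"
      using less assms(1) M[of 0] M[of 1]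
      by (simp add: head_pattern_def map_add_right_upt del: upt_Suc)
    then show ?thesis unfolding P_def by (metis avoiding_gf_shift avoiding_gf_increasing)
  qed
  \<comment> \<open>Lowering the first \<open>j\<close> blocks by \<open>m j\<close> makes their
    final endpoint 0 and does not affect containment.\<close>
  have Pj: "layered_gf (map (\<lambda>i. m i - m j) [0..<j]) = P j" if "2 \<le> j" "j \<le> r" for j
  proof -
    have ge: "m j \<le> m l" if "l \<le> j" for l
      by (rule decreasing_between[of 0]) (use that \<open>j \<le> r\<close> assms(2) in auto)
    have "layered (map (\<lambda>i. m i - m j) [0..<j]) = blocks (\<lambda>i. m i - m j) 0 j"
      by (rule layered_eq_blocks) auto
    also have "map (\<lambda>x. x + m j) \<dots> = blocks M 0 j"
      unfolding blocks_def map_concat map_map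
    proof (intro arg_cong[of _ _ concat] map_cong refl)
      fix l assume "l \<in> set [0..<j]"
      then show "(map (\<lambda>x. x + m j) \<circ> (\<lambda>l. [Suc (m (Suc l) - m j)..<Suc (m l - m j)])) l =
          [Suc (M (Suc l))..<Suc (M l)]"
        using ge[of l] ge[of "Suc l"] M[of l] M[of "Suc l"] that
        by (simp add: map_add_right_upt del: upt_Suc)
    qed
    finally have "map (\<lambda>x. x + m j) (layered (map (\<lambda>i. m i - m j) [0..<j])) = head_pattern M j"
      using that by (simp add: head_pattern_def)
    then show ?thesis unfolding P_def by (metis avoiding_gf_shift)
  qed
  have "S 0 = 1 + fps_X * (\<Sum>j<Suc r. (P (Suc j) - P j) * S j)"
    unfolding S_def P_def by (rule layered_gf_recurrence) (use dec assms(1) in auto)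
  also note summation_by_parts[of r P S, OF assms(1) P0]
  finally have rec: "S 0 = 1 + fps_X * (P 1 * S 0 + S 0 * S r - P 1 * S 1 +
      (\<Sum>j = 2..r. P j * (S (j - 1) - S j)))"
    by (simp only: S0[symmetric])
  have sum: "(\<Sum>j = 2..r. layered_gf (map (\<lambda>i. m i - m j) [0..<j])
       * (layered_gf (map m [j - 1..<Suc r]) - layered_gf (map m [j..<Suc r]))) =
     (\<Sum>j = 2..r. P j * (S (j - 1) - S j))"
    by (intro sum.cong refl) (auto simp: Pj S_eq simp del: upt_Suc)
  \<comment> \<open>Moving all terms with the unknown series to the left is pure ring algebra,
    stated for arbitrary series to keep the terms opaque.\<close>
  have "F - x * (p * F + F * s - p * t + q) = 1 \<Longrightarrow> (1 - x * p - x * s) * F = 1 - x * p * t + x * q"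
    for F x p s t q :: "real fps"
    by (simp add: algebra_simps)
  moreover have "S 0 - fps_X * (P 1 * S 0 + S 0 * S r - P 1 * S 1 +
      (\<Sum>j = 2..r. P j * (S (j - 1) - S j))) = 1"
    \<comment> \<open>Only the first \<open>S 0\<close> may be unfolded, since the right-hand side
      of \<open>rec\<close> contains \<open>S 0\<close> again.\<close>
    by (subst (1) rec) simp
  ultimately show ?thesis
    unfolding sum S_eq[OF le0] S1 P1[symmetric] Sr[symmetric] by blast
qed

end
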